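(* Let $\mathcal{E}:\ 0\to A\xrightarrow{\iota}E\xrightarrow{\pi}B\to0$ be a non-abelian extension of a perm algebra $B$ by a perm algebra $A$, and let $\varsigma$ be a section of $\mathcal{E}$. A pair $(\beta,\gamma)\in\mathrm{Aut}(A)\times\mathrm{Aut}(B)$ is inducible if and only if the non-abelian 2-cocycles $(\triangleright,\triangleleft,\chi)$ and $(\triangleright^{\beta,\gamma},\triangleleft^{\beta,\gamma},\chi^{\beta,\gamma})$ are equivalent, where $(\triangleright,\triangleleft,\chi)$ is the non-abelian 2-cocycle corresponding to $\mathcal{E}$ with section $\varsigma$.
   Context: All vector spaces are over a field $\mathbb{K}$ of characteristic zero. A perm algebra is a vector space $A$ with a bilinear product satisfying $(a_1a_2)a_3=a_1(a_2a_3)=a_1(a_3a_2)$ (no unit is required). $\mathrm{Aut}$ denotes the group of perm algebra automorphisms. A non-abelian extension of $B$ by $A$ is a short exact sequence of perm algebras $0\to A\xrightarrow{\iota}E\xrightarrow{\pi}B\to0$; $A$ is identified with the subalgebra $\iota(A)$ of $E$. A section is a linear map $\varsigma:B\to E$ with $\pi\circ\varsigma=\mathrm{id}_B$. Put $\mathrm{Aut}_A(E)=\{\alpha\in\mathrm{Aut}(E):\alpha(A)=A\}$ and, for $\alpha\in\mathrm{Aut}_A(E)$, $\bar\alpha:=\pi\circ\alpha\circ\varsigma\in\mathrm{Aut}(B)$ (independent of $\varsigma$). A pair $(\beta,\gamma)\in\mathrm{Aut}(A)\times\mathrm{Aut}(B)$ is inducible if there is $\alpha\in\mathrm{Aut}_A(E)$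 with $(\beta,\gamma)=(\alpha|_A,\bar\alpha)$. The non-abelian 2-cocycle corresponding to $\mathcal{E}$ with section $\varsigma$ is the triple of bilinear maps $b\triangleright a=\varsigma(b)a$, $a\triangleleft b=a\varsigma(b)$, $\chi(b_1,b_2)=\varsigma(b_1)\varsigma(b_2)-\varsigma(b_1b_2)$ (products in $E$). In general, a non-abelian 2-cocycle on $B$ with values in $A$ is a triple of bilinear maps $\triangleright:B\times A\to A$, $\triangleleft:A\times B\to A$, $\chi:B\times B\to A$ such that $A\oplus B$ with product $(a_1,b_1)(a_2,b_2)=(a_1a_2+b_1\triangleright a_2+a_1\triangleleft b_2+\chi(b_1,b_2),\,b_1b_2)$ is a perm algebra. For $(\beta,\gamma)\in\mathrm{Aut}(A)\times\mathrm{Aut}(B)$ the triple $(\triangleright^{\beta,\gamma},\triangleleft^{\beta,\gamma},\chi^{\beta,\gamma})$, again a non-abelian 2-cocycle, is defined by $\triangleright^{\beta,\gamma}(b,a)=\beta(\gamma^{-1}(b)\triangleright\beta^{-1}(a))$, $\triangleleft^{\beta,\gamma}(a,b)=\beta(\beta^{-1}(a)\triangleleft\gamma^{-1}(b))$, $\chi^{\beta,\gamma}(b_1,b_2)=\beta(\chi(\gamma^{-1}(b_1),\gamma^{-1}(b_2)))$. Cocycles $(\triangleright,\triangleleft,\chi)$ and $(\triangleright',\triangleleft',\chi')$ are equivalent if there is a linear map $\lambda:B\to A$ such that for all $a\in A$, $b,b_1,b_2\in B$: $a\triangleleft b-a\triangleleft'b=a\lambda(b)$, $b\triangleright a-b\triangleright'a=\lambda(b)a$,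 and $\chi(b_1,b_2)-\chi'(b_1,b_2)=\lambda(b_1)\lambda(b_2)+b_1\triangleright'\lambda(b_2)+\lambda(b_1)\triangleleft'b_2-\lambda(b_1b_2)$. *)

theory Defs
  imports "HOL-Analysis.Product_Vector"
begin

text \<open>A perm algebra over \<open>'k\<close> consists of a whole type \<open>'a\<close>, its scalar multiplication and its
  product; the three algebras of an extension therefore live on three separate types.\<close>

definition bilinear_map ::
  "('k::field \<Rightarrow> 'a::ab_group_add \<Rightarrow> 'a) \<Rightarrow> ('k \<Rightarrow> 'b::ab_group_add \<Rightarrow> 'b) \<Rightarrow>
   ('k \<Rightarrow> 'c::ab_group_add \<Rightarrow> 'c) \<Rightarrow> ('a \<Rightarrow> 'b \<Rightarrow> 'c) \<Rightarrow> bool" where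
  "bilinear_map s1 s2 s3 f \<longleftrightarrow>
     (\<forall>x. Vector_Spaces.linear s2 s3 (\<lambda>y. f x y)) \<and>
     (\<forall>y. Vector_Spaces.linear s1 s3 (\<lambda>x. f x y))"

locale perm_algebra = vector_space scale
  for scale :: "'k::field_char_0 \<Rightarrow> 'a::ab_group_add \<Rightarrow> 'a" +
  fixes mult :: "'a \<Rightarrow> 'a \<Rightarrow> 'a"
  assumes bilinear_mult: "bilinear_map scale scale scale mult"
    and mult_assoc: "mult (mult x y) z = mult x (mult y z)"
    and mult_perm: "mult x (mult y z) = mult x (mult z y)"

definition perm_hom ::
  "('k::field_char_0 \<Rightarrow> 'a::ab_group_add \<Rightarrow> 'a) \<Rightarrow> ('a \<Rightarrow> 'a \<Rightarrow> 'a) \<Rightarrow>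
   ('k \<Rightarrow> 'b::ab_group_add \<Rightarrow> 'b) \<Rightarrow> ('b \<Rightarrow> 'b \<Rightarrow> 'b) \<Rightarrow> ('a \<Rightarrow> 'b) set" where
  "perm_hom sA mA sB mB =
     {f. Vector_Spaces.linear sA sB f \<and> (\<forall>x y. f (mA x y) = mB (f x) (f y))}"

definition perm_Aut ::
  "('k::field_char_0 \<Rightarrow> 'a::ab_group_add \<Rightarrow> 'a) \<Rightarrow> ('a \<Rightarrow> 'a \<Rightarrow> 'a) \<Rightarrow> ('a \<Rightarrow> 'a) set" where
  "perm_Aut s m = {f \<in> perm_hom s m s m. bij f}"

locale nonabelian_extension =
  A: perm_algebra sA mA + E: perm_algebra sE mE + B: perm_algebra sB mB
  for sA :: "'k::field_char_0 \<Rightarrow> 'a::ab_group_add \<Rightarrow> 'a" and mA :: "'a \<Rightarrow> 'a \<Rightarrow> 'a"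
    and sE :: "'k \<Rightarrow> 'e::ab_group_add \<Rightarrow> 'e" and mE :: "'e \<Rightarrow> 'e \<Rightarrow> 'e"
    and sB :: "'k \<Rightarrow> 'b::ab_group_add \<Rightarrow> 'b" and mB :: "'b \<Rightarrow> 'b \<Rightarrow> 'b" +
  fixes \<iota> :: "'a \<Rightarrow> 'e" and \<pi> :: "'e \<Rightarrow> 'b"
  assumes iota_hom: "\<iota> \<in> perm_hom sA mA sE mE"
    and pi_hom: "\<pi> \<in> perm_hom sE mE sB mB"
    and inj_iota: "inj \<iota>"
    and exact: "range \<iota> = {e. \<pi> e = 0}"
    and surj_pi: "surj \<pi>"

definition linear_section ::
  "('k::field_char_0 \<Rightarrow> 'e::ab_group_add \<Rightarrow> 'e) \<Rightarrow> ('k \<Rightarrow> 'b::ab_group_add \<Rightarrow> 'b) \<Rightarrow>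
   ('e \<Rightarrow> 'b) \<Rightarrow> ('b \<Rightarrow> 'e) \<Rightarrow> bool" where
  "linear_section sE sB \<pi> \<sigma> \<longleftrightarrow> Vector_Spaces.linear sB sE \<sigma> \<and> \<pi> \<circ> \<sigma> = id"

definition Aut_preserving ::
  "('k::field_char_0 \<Rightarrow> 'e::ab_group_add \<Rightarrow> 'e) \<Rightarrow> ('e \<Rightarrow> 'e \<Rightarrow> 'e) \<Rightarrow> ('a \<Rightarrow> 'e) \<Rightarrow>
   ('e \<Rightarrow> 'e) set" where
  "Aut_preserving sE mE \<iota> = {\<alpha> \<in> perm_Aut sE mE. \<alpha> ` range \<iota> = range \<iota>}"

text \<open>The restriction of \<open>\<alpha>\<close> to the subalgebra \<open>range \<iota>\<close>, read as a map on \<open>'a\<close>; meaningful only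
  when \<open>\<iota>\<close> is injective and \<open>\<alpha>\<close> maps \<open>range \<iota>\<close> to itself.\<close>

definition restrict_to_sub :: "('a \<Rightarrow> 'e) \<Rightarrow> ('e \<Rightarrow> 'e) \<Rightarrow> ('a \<Rightarrow> 'a)" where
  "restrict_to_sub \<iota> \<alpha> = inv \<iota> \<circ> \<alpha> \<circ> \<iota>"

definition induced_quotient :: "('e \<Rightarrow> 'b) \<Rightarrow> ('b \<Rightarrow> 'e) \<Rightarrow> ('e \<Rightarrow> 'e) \<Rightarrow> ('b \<Rightarrow> 'b)" where
  "induced_quotient \<pi> \<sigma> \<alpha> = \<pi> \<circ> \<alpha> \<circ> \<sigma>"

text \<open>The induced map on the quotient does not depend on the section, so \<open>inducible\<close> below
  does not depend on its argument \<open>\<sigma>\<close>.\<close>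

lemma (in nonabelian_extension) induced_quotient_section_indep:
  assumes "linear_section sE sB \<pi> \<sigma>" "linear_section sE sB \<pi> \<sigma>'"
    and "\<alpha> \<in> Aut_preserving sE mE \<iota>"
  shows "induced_quotient \<pi> \<sigma> \<alpha> = induced_quotient \<pi> \<sigma>' \<alpha>"
proof
  fix b
  have lp: "Vector_Spaces.linear sE sB \<pi>" using pi_hom by (simp add: perm_hom_def)
  have la: "Vector_Spaces.linear sE sE \<alpha>"
    using assms(3) by (simp add: Aut_preserving_def perm_Aut_def perm_hom_def)
  interpret P: Vector_Spaces.linear sE sB \<pi> by (rule lp)
  interpret L: Vector_Spaces.linear sE sE \<alpha> by (rule la)
  have "\<pi> (\<sigma> b) = b" "\<pi> (\<sigma>' b) = b"
    using assms(1,2) by (auto simp: linear_section_def fun_eq_iff)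
  then have "\<sigma> b - \<sigma>' b \<in> range \<iota>" by (simp add: exact P.diff)
  then have "\<alpha> (\<sigma> b - \<sigma>' b) \<in> range \<iota>" using assms(3) unfolding Aut_preserving_def by blast
  then have "\<pi> (\<alpha> (\<sigma> b - \<sigma>' b)) = 0" using exact by blast
  then show "induced_quotient \<pi> \<sigma> \<alpha> b = induced_quotient \<pi> \<sigma>' \<alpha> b"
    by (simp add: induced_quotient_def P.diff L.diff)
qed

definition inducible ::
  "('k::field_char_0 \<Rightarrow> 'e::ab_group_add \<Rightarrow> 'e) \<Rightarrow> ('e \<Rightarrow> 'e \<Rightarrow> 'e) \<Rightarrow> ('a \<Rightarrow> 'e) \<Rightarrow> ('e \<Rightarrow> 'b) \<Rightarrow>
   ('b \<Rightarrow> 'e) \<Rightarrow> ('a \<Rightarrow> 'a) \<times> ('b \<Rightarrow> 'b) \<Rightarrow> bool" where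
  "inducible sE mE \<iota> \<pi> \<sigma> p \<longleftrightarrow>
     (\<exists>\<alpha> \<in> Aut_preserving sE mE \<iota>. p = (restrict_to_sub \<iota> \<alpha>, induced_quotient \<pi> \<sigma> \<alpha>))"

text \<open>A triple \<open>(l, r, \<chi>)\<close> collects the left action \<open>l b a\<close>, the right action \<open>r a b\<close> and the map
  \<open>\<chi> b b'\<close>.\<close>

type_synonym ('a, 'b) cocycle_data = "('b \<Rightarrow> 'a \<Rightarrow> 'a) \<times> ('a \<Rightarrow> 'b \<Rightarrow> 'a) \<times> ('b \<Rightarrow> 'b \<Rightarrow> 'a)"

fun cocycle_product ::
  "('a::ab_group_add \<Rightarrow> 'a \<Rightarrow> 'a) \<Rightarrow> ('b \<Rightarrow> 'b \<Rightarrow> 'b) \<Rightarrow> ('a, 'b) cocycle_data \<Rightarrow>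
   'a \<times> 'b \<Rightarrow> 'a \<times> 'b \<Rightarrow> 'a \<times> 'b" where
  "cocycle_product mA mB (l, r, \<chi>) (a1, b1) (a2, b2) =
     (mA a1 a2 + l b1 a2 + r a1 b2 + \<chi> b1 b2, mB b1 b2)"

fun nonabelian_2_cocycle ::
  "('k::field_char_0 \<Rightarrow> 'a::ab_group_add \<Rightarrow> 'a) \<Rightarrow> ('a \<Rightarrow> 'a \<Rightarrow> 'a) \<Rightarrow>
   ('k \<Rightarrow> 'b::ab_group_add \<Rightarrow> 'b) \<Rightarrow> ('b \<Rightarrow> 'b \<Rightarrow> 'b) \<Rightarrow> ('a, 'b) cocycle_data \<Rightarrow> bool" where
  "nonabelian_2_cocycle sA mA sB mB (l, r, \<chi>) \<longleftrightarrow>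
     bilinear_map sB sA sA l \<and> bilinear_map sA sB sA r \<and> bilinear_map sB sB sA \<chi> \<and>
     perm_algebra (module_prod.scale sA sB) (cocycle_product mA mB (l, r, \<chi>))"

text \<open>The products below are taken in \<open>E\<close> and lie in \<open>range \<iota>\<close>; \<open>inv \<iota>\<close> reads them in \<open>A\<close>.\<close>

definition extension_cocycle ::
  "('e::ab_group_add \<Rightarrow> 'e \<Rightarrow> 'e) \<Rightarrow> ('b \<Rightarrow> 'b \<Rightarrow> 'b) \<Rightarrow> ('a \<Rightarrow> 'e) \<Rightarrow> ('b \<Rightarrow> 'e) \<Rightarrow>
   ('a, 'b) cocycle_data" where
  "extension_cocycle mE mB \<iota> \<sigma> =
     ((\<lambda>b a. inv \<iota> (mE (\<sigma> b) (\<iota> a))),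
      (\<lambda>a b. inv \<iota> (mE (\<iota> a) (\<sigma> b))),
      (\<lambda>b1 b2. inv \<iota> (mE (\<sigma> b1) (\<sigma> b2) - \<sigma> (mB b1 b2))))"

fun twisted_cocycle ::
  "('a \<Rightarrow> 'a) \<Rightarrow> ('b \<Rightarrow> 'b) \<Rightarrow> ('a, 'b) cocycle_data \<Rightarrow> ('a, 'b) cocycle_data" where
  "twisted_cocycle \<beta> \<gamma> (l, r, \<chi>) =
     ((\<lambda>b a. \<beta> (l (inv \<gamma> b) (inv \<beta> a))),
      (\<lambda>a b. \<beta> (r (inv \<beta> a) (inv \<gamma> b))),
      (\<lambda>b1 b2. \<beta> (\<chi> (inv \<gamma> b1) (inv \<gamma> b2))))"

fun equivalent_via ::
  "('a::ab_group_add \<Rightarrow> 'a \<Rightarrow> 'a) \<Rightarrow> ('b \<Rightarrow> 'b \<Rightarrow> 'b) \<Rightarrow> ('b \<Rightarrow> 'a) \<Rightarrow>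
   ('a, 'b) cocycle_data \<Rightarrow> ('a, 'b) cocycle_data \<Rightarrow> bool" where
  "equivalent_via mA mB h (l, r, \<chi>) (l', r', \<chi>') \<longleftrightarrow>
     (\<forall>a b. r a b - r' a b = mA a (h b)) \<and>
     (\<forall>a b. l b a - l' b a = mA (h b) a) \<and>
     (\<forall>b1 b2. \<chi> b1 b2 - \<chi>' b1 b2 =
        mA (h b1) (h b2) + l' b1 (h b2) + r' (h b1) b2 - h (mB b1 b2))"

text \<open>Equivalence is a relation between non-abelian 2-cocycles, so being cocycles is part of it.\<close>

definition equivalent_cocycles ::
  "('k::field_char_0 \<Rightarrow> 'a::ab_group_add \<Rightarrow> 'a) \<Rightarrow> ('a \<Rightarrow> 'a \<Rightarrow> 'a) \<Rightarrow>
   ('k \<Rightarrow> 'b::ab_group_add \<Rightarrow> 'b) \<Rightarrow> ('b \<Rightarrow> 'b \<Rightarrow> 'b) \<Rightarrow>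
   ('a, 'b) cocycle_data \<Rightarrow> ('a, 'b) cocycle_data \<Rightarrow> bool" where
  "equivalent_cocycles sA mA sB mB c c' \<longleftrightarrow>
     nonabelian_2_cocycle sA mA sB mB c \<and> nonabelian_2_cocycle sA mA sB mB c' \<and>
     (\<exists>h. Vector_Spaces.linear sB sA h \<and> equivalent_via mA mB h c c')"

end

theory Submission
  imports Defs
begin

text \<open>A section \<open>s\<close> identifies \<open>E\<close> with \<open>A \<times> B\<close> through \<open>(a, b) \<mapsto> \<iota> a + s b\<close>, and the product of \<open>E\<close>
  then becomes the product defined by the cocycle of \<open>s\<close>. This is why \<open>extension_cocycle\<close> yields a
  non-abelian 2-cocycle (\<open>nonabelian_2_cocycle_extension_cocycle\<close>). Both sides of
  the theorem then say the same: the twist of the cocycle of \<open>s\<close> by \<open>(\<beta>, \<gamma>)\<close> is the cocycle of some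
  section of the extension.

  \<^item> Any other section has the form \<open>s - \<iota> \<circ> h\<close> for a linear map \<open>h\<close>, and the identities
    defining equivalence via \<open>h\<close> say precisely that the second triple is the cocycle of
    \<open>s - \<iota> \<circ> h\<close> (\<open>equivalent_via_extension_cocycle_iff\<close>). So a triple is equivalent to the cocycle
    of \<open>s\<close> exactly when it is the cocycle of some section
    (\<open>equivalent_cocycles_extension_cocycle_iff\<close>).

  \<^item> If \<open>\<alpha>\<close> induces \<open>(\<beta>, \<gamma>)\<close>, then \<open>\<alpha> \<circ> s \<circ> \<gamma>\<inverse>\<close> is a section, and applying \<open>\<alpha>\<close> to the identities
    defining the cocycle of \<open>s\<close> shows that its cocycle is the twist by \<open>(\<beta>, \<gamma>)\<close>. Conversely, if the
    twist is the cocycle of a section \<open>s'\<close>, then \<open>\<iota> a + s b \<mapsto> \<iota> (\<beta> a) + s' (\<gamma> b)\<close> is an automorphism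
    that induces \<open>(\<beta>, \<gamma>)\<close>. So \<open>(\<beta>, \<gamma>)\<close> is inducible exactly when the twist is the cocycle of some
    section (\<open>inducible_iff_section\<close>).\<close>

section \<open>Bilinear products and perm algebras\<close>

lemma bilinear_map_iff:
  "bilinear_map s1 s2 s3 f \<longleftrightarrow>
     vector_space s1 \<and> vector_space s2 \<and> vector_space s3 \<and>
     (\<forall>x y z. f (x + y) z = f x z + f y z) \<and> (\<forall>c x z. f (s1 c x) z = s3 c (f x z)) \<and>
     (\<forall>x y z. f x (y + z) = f x y + f x z) \<and> (\<forall>c x z. f x (s2 c z) = s3 c (f x z))"
  by (auto simp: bilinear_map_def Vector_Spaces.linear_iff)

context perm_algebra
begin

lemma mult_add_left: "mult (x + y) z = mult x z + mult y z"
  and mult_add_right: "mult x (y + z) = mult x y + mult x z"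
  and mult_scale_left: "mult (scale c x) z = scale c (mult x z)"
  and mult_scale_right: "mult x (scale c z) = scale c (mult x z)"
  using bilinear_mult by (auto simp: bilinear_map_iff)

lemma mult_diff_left: "mult (x - y) z = mult x z - mult y z"
  and mult_diff_right: "mult x (y - z) = mult x y - mult x z"
  using mult_add_left[of "x - y" y z] mult_add_right[of x "y - z" z]
  by (simp_all add: algebra_simps)

end

lemma perm_algebra_pullback:
  fixes sV :: "'k::field_char_0 \<Rightarrow> 'v::ab_group_add \<Rightarrow> 'v"
    and sW :: "'k \<Rightarrow> 'w::ab_group_add \<Rightarrow> 'w"
  assumes W: "perm_algebra sW mW"
    and lin: "Vector_Spaces.linear sV sW \<phi>" and inj: "inj \<phi>"
    and hom: "\<And>x y. \<phi> (mV x y) = mW (\<phi> x) (\<phi> y)"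
  shows "perm_algebra sV mV"
proof -
  interpret W: perm_algebra sW mW by (rule W)
  interpret V: vector_space sV using lin by (simp add: Vector_Spaces.linear_iff)
  interpret \<phi>: Vector_Spaces.linear sV sW \<phi> by (rule lin)
  have bil: "bilinear_map sV sV sV mV"
    unfolding bilinear_map_iff
    by (intro conjI allI V.vector_space_axioms injD[OF inj])
      (simp_all add: hom \<phi>.add \<phi>.scale W.mult_add_left W.mult_add_right
        W.mult_scale_left W.mult_scale_right)
  show ?thesis
  proof
    show "bilinear_map sV sV sV mV" by (rule bil)
    show "mV (mV x y) z = mV x (mV y z)" for x y z
      by (rule injD[OF inj]) (simp add: hom W.mult_assoc)
    show "mV x (mV y z) = mV x (mV z y)" for x y z
      by (rule injD[OF inj]) (simp add: hom W.mult_perm[of "\<phi> x" "\<phi> y"])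
  qed
qed

lemma perm_homD:
  assumes "f \<in> perm_hom sA mA sB mB"
  shows "Vector_Spaces.linear sA sB f" and "f (mA x y) = mB (f x) (f y)"
  using assms by (auto simp: perm_hom_def)

lemma perm_AutD:
  assumes "f \<in> perm_Aut s m"
  shows "Vector_Spaces.linear s s f" and "f (m x y) = m (f x) (f y)" and "bij f"
  using assms by (auto simp: perm_Aut_def perm_hom_def)

lemma linear_inv_of_bij:
  assumes lin: "Vector_Spaces.linear s1 s2 f" and bij: "bij f"
  shows "Vector_Spaces.linear s2 s1 (inv f)"
proof -
  interpret f: Vector_Spaces.linear s1 s2 f by (rule lin)
  have "f (inv f y) = y" for y
    using bij by (simp add: bij_is_surj surj_f_inv_f)
  then show ?thesis
    unfolding Vector_Spaces.linear_iff
    by (intro conjI allI f.vs1.vector_space_axioms f.vs2.vector_space_axioms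
        injD[OF bij_is_inj[OF bij]])
      (simp_all add: f.add f.scale)
qed

section \<open>Sections and their cocycles\<close>

text \<open>The identification of \<open>A \<times> B\<close> with \<open>E\<close> given by a section \<open>s\<close>.\<close>

definition glue :: "('a \<Rightarrow> 'e::ab_group_add) \<Rightarrow> ('b \<Rightarrow> 'e) \<Rightarrow> 'a \<times> 'b \<Rightarrow> 'e" where
  "glue \<iota> s x = \<iota> (fst x) + s (snd x)"

context nonabelian_extension
begin

sublocale iota: Vector_Spaces.linear sA sE \<iota>
  using iota_hom by (rule perm_homD)

sublocale pi: Vector_Spaces.linear sE sB \<pi>
  using pi_hom by (rule perm_homD)

lemmas iota_mult = perm_homD(2)[OF iota_hom]
lemmas pi_mult = perm_homD(2)[OF pi_hom]

lemma iota_eq_iff: "\<iota> x = \<iota> y \<longleftrightarrow> x = y"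
  using inj_iota by (auto dest: injD)

lemma pi_iota: "\<pi> (\<iota> a) = 0"
  using exact by blast

lemma iota_inv_iota: "\<pi> e = 0 \<Longrightarrow> \<iota> (inv \<iota> e) = e"
  by (rule f_inv_into_f) (simp add: exact)

lemma linear_section_iff:
  "linear_section sE sB \<pi> s \<longleftrightarrow>
     (\<forall>x y. s (x + y) = s x + s y) \<and> (\<forall>c x. s (sB c x) = sE c (s x)) \<and> (\<forall>b. \<pi> (s b) = b)"
  by (auto simp: linear_section_def Vector_Spaces.linear_iff fun_eq_iff
      B.vector_space_axioms E.vector_space_axioms)

lemma mult_zero_B: "mB 0 b = 0" "mB b 0 = 0"
  using B.mult_add_left[of 0 0 b] B.mult_add_right[of b 0 0] by simp_all

text \<open>The products defining the cocycle lie in the kernel of \<open>\<pi>\<close>, so the uses of \<open>inv \<iota>\<close> in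
  \<open>extension_cocycle\<close> can be eliminated.\<close>

lemma extension_cocycle_eq_iff:
  assumes s: "linear_section sE sB \<pi> s"
  shows "extension_cocycle mE mB \<iota> s = (l, r, \<chi>) \<longleftrightarrow>
    (\<forall>b a. \<iota> (l b a) = mE (s b) (\<iota> a)) \<and> (\<forall>a b. \<iota> (r a b) = mE (\<iota> a) (s b)) \<and>
    (\<forall>b b'. \<iota> (\<chi> b b') = mE (s b) (s b') - s (mB b b'))"
proof -
  have pis: "\<pi> (s b) = b" for b using s by (simp add: linear_section_iff)
  have inv_eq: "inv \<iota> e = a \<longleftrightarrow> \<iota> a = e" if "\<pi> e = 0" for e a
    using iota_inv_iota[OF that] iota_eq_iff by metis
  have "inv \<iota> (mE (s b) (\<iota> a)) = l b a \<longleftrightarrow> \<iota> (l b a) = mE (s b) (\<iota> a)"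
    and "inv \<iota> (mE (\<iota> a) (s b)) = r a b \<longleftrightarrow> \<iota> (r a b) = mE (\<iota> a) (s b)"
    and "inv \<iota> (mE (s b) (s b') - s (mB b b')) = \<chi> b b' \<longleftrightarrow>
      \<iota> (\<chi> b b') = mE (s b) (s b') - s (mB b b')" for a b b'
    by (rule inv_eq; simp add: pi_mult pi_iota pis mult_zero_B pi.diff)+
  then show ?thesis
    by (simp add: extension_cocycle_def fun_eq_iff)
qed

lemma extension_cocycleE:
  assumes "linear_section sE sB \<pi> s"
  obtains l r \<chi> where "extension_cocycle mE mB \<iota> s = (l, r, \<chi>)"
    and "\<And>b a. \<iota> (l b a) = mE (s b) (\<iota> a)" and "\<And>a b. \<iota> (r a b) = mE (\<iota> a) (s b)"
    and "\<And>b b'. \<iota> (\<chi> b b') = mE (s b) (s b') - s (mB b b')"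
proof -
  obtain l r \<chi> where c: "extension_cocycle mE mB \<iota> s = (l, r, \<chi>)" by (rule prod_cases3)
  with extension_cocycle_eq_iff[OF assms, of l r \<chi>] that show ?thesis by blast
qed

sublocale AB: vector_space_prod sA sB ..

lemma linear_glue:
  assumes "linear_section sE sB \<pi> s"
  shows "Vector_Spaces.linear (module_prod.scale sA sB) sE (glue \<iota> s)"
  using assms
  by (simp add: Vector_Spaces.linear_iff linear_section_iff glue_def AB.scale_def iota.add iota.scale
      E.scale_right_distrib AB.p.vector_space_axioms E.vector_space_axioms add_ac)

lemma bij_glue:
  assumes s: "linear_section sE sB \<pi> s"
  shows "bij (glue \<iota> s)"
proof (rule bijI)
  have pis: "\<pi> (s b) = b" for b using s by (simp add: linear_section_iff)
  show "inj (glue \<iota> s)"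
  proof (rule injI)
    fix x y assume eq: "glue \<iota> s x = glue \<iota> s y"
    have "\<pi> (glue \<iota> s z) = snd z" for z
      by (simp add: glue_def pi.add pi_iota pis)
    with eq have "snd x = snd y" by metis
    with eq show "x = y" by (simp add: glue_def iota_eq_iff prod_eq_iff)
  qed
  have "e = glue \<iota> s (inv \<iota> (e - s (\<pi> e)), \<pi> e)" for e
    by (simp add: glue_def iota_inv_iota pi.diff pis)
  then show "surj (glue \<iota> s)" by (rule surjI[OF sym])
qed

lemma glue_cocycle_product:
  assumes s: "linear_section sE sB \<pi> s"
  shows "glue \<iota> s (cocycle_product mA mB (extension_cocycle mE mB \<iota> s) x y) =
    mE (glue \<iota> s x) (glue \<iota> s y)"
proof -
  obtain l r \<chi> where c: "extension_cocycle mE mB \<iota> s = (l, r, \<chi>)"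
    and "\<And>b a. \<iota> (l b a) = mE (s b) (\<iota> a)" "\<And>a b. \<iota> (r a b) = mE (\<iota> a) (s b)"
    and "\<And>b b'. \<iota> (\<chi> b b') = mE (s b) (s b') - s (mB b b')"
    by (rule extension_cocycleE[OF s]) blast
  then show ?thesis
    unfolding c
    by (cases x; cases y)
      (simp add: glue_def iota.add iota_mult E.mult_add_left E.mult_add_right algebra_simps)
qed

lemma nonabelian_2_cocycle_extension_cocycle:
  assumes s: "linear_section sE sB \<pi> s"
  shows "nonabelian_2_cocycle sA mA sB mB (extension_cocycle mE mB \<iota> s)"
proof -
  obtain l r \<chi> where c: "extension_cocycle mE mB \<iota> s = (l, r, \<chi>)"
    and l: "\<And>b a. \<iota> (l b a) = mE (s b) (\<iota> a)" and r: "\<And>a b. \<iota> (r a b) = mE (\<iota> a) (s b)"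
    and \<chi>: "\<And>b b'. \<iota> (\<chi> b b') = mE (s b) (s b') - s (mB b b')"
    by (rule extension_cocycleE[OF s]) blast
  have sadd: "s (x + y) = s x + s y" and sscale: "s (sB k x) = sE k (s x)" for x y k
    using s by (auto simp: linear_section_iff)
  note linear_rules = sadd sscale iota.add iota.scale E.mult_add_left E.mult_add_right
    E.mult_scale_left E.mult_scale_right B.mult_add_left B.mult_add_right
    B.mult_scale_left B.mult_scale_right E.scale_right_diff_distrib
  have "bilinear_map sB sA sA l" "bilinear_map sA sB sA r" "bilinear_map sB sB sA \<chi>"
    unfolding bilinear_map_iff
    by (intro conjI allI A.vector_space_axioms B.vector_space_axioms injD[OF inj_iota];
        simp add: l r \<chi> linear_rules)+
  moreover have "perm_algebra (module_prod.scale sA sB) (cocycle_product mA mB (l, r, \<chi>))"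
    using perm_algebra_pullback[OF E.perm_algebra_axioms linear_glue[OF s]
        bij_is_inj[OF bij_glue[OF s]]] glue_cocycle_product[OF s]
    by (simp add: c)
  ultimately show ?thesis by (simp add: c)
qed

section \<open>Equivalence as a change of section\<close>

lemma linear_section_diff:
  assumes "linear_section sE sB \<pi> s" and "Vector_Spaces.linear sB sA h"
  shows "linear_section sE sB \<pi> (\<lambda>b. s b - \<iota> (h b))"
  using assms
  by (simp add: linear_section_iff Vector_Spaces.linear_iff iota.add iota.scale pi.diff pi_iota
      E.scale_right_diff_distrib)

lemma linear_section_difference:
  assumes s: "linear_section sE sB \<pi> s" and s': "linear_section sE sB \<pi> s'"
  obtains h where "Vector_Spaces.linear sB sA h" and "s' = (\<lambda>b. s b - \<iota> (h b))"
proof -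
  define h where "h = (\<lambda>b. inv \<iota> (s b - s' b))"
  have h: "\<iota> (h b) = s b - s' b" for b
    unfolding h_def using s s' by (intro iota_inv_iota) (simp add: linear_section_iff pi.diff)
  have "Vector_Spaces.linear sB sA h"
    unfolding Vector_Spaces.linear_iff using s s'
    by (intro conjI allI A.vector_space_axioms B.vector_space_axioms injD[OF inj_iota])
      (simp_all add: h iota.add iota.scale linear_section_iff E.scale_right_diff_distrib)
  moreover have "s' = (\<lambda>b. s b - \<iota> (h b))" by (simp add: h)
  ultimately show ?thesis by (rule that)
qed

lemma equivalent_via_extension_cocycle_iff:
  assumes s: "linear_section sE sB \<pi> s" and h: "Vector_Spaces.linear sB sA h"
  shows "equivalent_via mA mB h (extension_cocycle mE mB \<iota> s) c' \<longleftrightarrow>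
    extension_cocycle mE mB \<iota> (\<lambda>b. s b - \<iota> (h b)) = c'"
proof -
  obtain l r \<chi> where c: "extension_cocycle mE mB \<iota> s = (l, r, \<chi>)"
    and l: "\<And>b a. \<iota> (l b a) = mE (s b) (\<iota> a)" and r: "\<And>a b. \<iota> (r a b) = mE (\<iota> a) (s b)"
    and \<chi>: "\<And>b b'. \<iota> (\<chi> b b') = mE (s b) (s b') - s (mB b b')"
    by (rule extension_cocycleE[OF s]) blast
  obtain l' r' \<chi>' where c': "c' = (l', r', \<chi>')" by (rule prod_cases3)
  have R: "r a b - r' a b = mA a (h b) \<longleftrightarrow> \<iota> (r' a b) = mE (\<iota> a) (s b - \<iota> (h b))" for a b
    unfolding iota_eq_iff[symmetric] iota.diff r iota_mult E.mult_diff_right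
    by (auto simp: algebra_simps)
  have L: "l b a - l' b a = mA (h b) a \<longleftrightarrow> \<iota> (l' b a) = mE (s b - \<iota> (h b)) (\<iota> a)" for a b
    unfolding iota_eq_iff[symmetric] iota.diff l iota_mult E.mult_diff_left
    by (auto simp: algebra_simps)
  \<comment> \<open>The identity for \<open>\<chi>\<close> involves the actions \<open>l'\<close> and \<open>r'\<close>, so it only characterises the cocycle of
    the new section once these are known to be its actions.\<close>
  have X: "\<chi> b b' - \<chi>' b b' = mA (h b) (h b') + l' b (h b') + r' (h b) b' - h (mB b b') \<longleftrightarrow>
      \<iota> (\<chi>' b b') = mE (s b - \<iota> (h b)) (s b' - \<iota> (h b')) - (s (mB b b') - \<iota> (h (mB b b')))"
    if "\<And>b a. \<iota> (l' b a) = mE (s b - \<iota> (h b)) (\<iota> a)"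
      and "\<And>a b. \<iota> (r' a b) = mE (\<iota> a) (s b - \<iota> (h b))" for b b'
    unfolding iota_eq_iff[symmetric] iota.diff iota.add \<chi> that iota_mult E.mult_diff_left
      E.mult_diff_right
    by (auto simp: algebra_simps)
  show ?thesis
    unfolding c c' extension_cocycle_eq_iff[OF linear_section_diff[OF s h]] equivalent_via.simps
      R L using X by auto
qed

lemma equivalent_cocycles_extension_cocycle_iff:
  assumes s: "linear_section sE sB \<pi> s"
  shows "equivalent_cocycles sA mA sB mB (extension_cocycle mE mB \<iota> s) c' \<longleftrightarrow>
    (\<exists>s'. linear_section sE sB \<pi> s' \<and> extension_cocycle mE mB \<iota> s' = c')"
proof
  assume "equivalent_cocycles sA mA sB mB (extension_cocycle mE mB \<iota> s) c'"
  then show "\<exists>s'. linear_section sE sB \<pi> s' \<and> extension_cocycle mE mB \<iota> s' = c'"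
    unfolding equivalent_cocycles_def
    using equivalent_via_extension_cocycle_iff[OF s] linear_section_diff[OF s] by blast
next
  assume "\<exists>s'. linear_section sE sB \<pi> s' \<and> extension_cocycle mE mB \<iota> s' = c'"
  then obtain s' where s': "linear_section sE sB \<pi> s'"
    and c': "extension_cocycle mE mB \<iota> s' = c'" by blast
  obtain h where h: "Vector_Spaces.linear sB sA h" and "s' = (\<lambda>b. s b - \<iota> (h b))"
    by (rule linear_section_difference[OF s s'])
  with c' have "equivalent_via mA mB h (extension_cocycle mE mB \<iota> s) c'"
    by (simp add: equivalent_via_extension_cocycle_iff[OF s])
  with h show "equivalent_cocycles sA mA sB mB (extension_cocycle mE mB \<iota> s) c'"
    unfolding equivalent_cocycles_def
    using nonabelian_2_cocycle_extension_cocycle[OF s]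
      nonabelian_2_cocycle_extension_cocycle[OF s'] c' by blast
qed

section \<open>Inducibility as a change of section\<close>

lemma inducibleE:
  assumes "inducible sE mE \<iota> \<pi> s (\<beta>, \<gamma>)"
  obtains \<alpha> where "\<alpha> \<in> perm_Aut sE mE" and "\<And>a. \<alpha> (\<iota> a) = \<iota> (\<beta> a)" and "\<And>b. \<pi> (\<alpha> (s b)) = \<gamma> b"
proof -
  from assms obtain \<alpha> where \<alpha>: "\<alpha> \<in> perm_Aut sE mE" "\<alpha> ` range \<iota> = range \<iota>"
    and \<beta>: "\<beta> = restrict_to_sub \<iota> \<alpha>" and \<gamma>: "\<gamma> = induced_quotient \<pi> s \<alpha>"
    by (auto simp: inducible_def Aut_preserving_def)
  have "\<iota> (\<beta> a) = \<alpha> (\<iota> a)" for a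
  proof -
    have "\<alpha> (\<iota> a) \<in> range \<iota>" using \<alpha>(2) by blast
    then show ?thesis by (simp add: \<beta> restrict_to_sub_def f_inv_into_f)
  qed
  with \<alpha>(1) \<gamma> show ?thesis by (intro that) (simp_all add: induced_quotient_def)
qed

lemma inducibleI:
  assumes \<alpha>: "\<alpha> \<in> perm_Aut sE mE" and \<beta>: "\<And>a. \<alpha> (\<iota> a) = \<iota> (\<beta> a)" and "surj \<beta>"
    and \<gamma>: "\<And>b. \<pi> (\<alpha> (s b)) = \<gamma> b"
  shows "inducible sE mE \<iota> \<pi> s (\<beta>, \<gamma>)"
proof -
  have "\<alpha> ` range \<iota> = \<iota> ` range \<beta>" by (simp add: image_image \<beta>)
  with \<alpha> have "\<alpha> \<in> Aut_preserving sE mE \<iota>" by (simp add: Aut_preserving_def \<open>surj \<beta>\<close>)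
  moreover have "\<beta> = restrict_to_sub \<iota> \<alpha>"
    by (simp add: restrict_to_sub_def fun_eq_iff \<beta> inv_f_f[OF inj_iota])
  moreover have "\<gamma> = induced_quotient \<pi> s \<alpha>"
    by (simp add: induced_quotient_def fun_eq_iff \<gamma>)
  ultimately show ?thesis by (auto simp: inducible_def)
qed

text \<open>An automorphism inducing \<open>(\<beta>, \<gamma>)\<close> carries \<open>s\<close> to a section whose cocycle is the twist of the
  cocycle of \<open>s\<close>. Precomposing with \<open>\<gamma>\<inverse>\<close> is what makes \<open>\<alpha> \<circ> s\<close> a section again.\<close>

lemma extension_cocycle_transport:
  assumes s: "linear_section sE sB \<pi> s" and \<beta>: "\<beta> \<in> perm_Aut sA mA" and \<gamma>: "\<gamma> \<in> perm_Aut sB mB"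
    and \<alpha>: "\<alpha> \<in> perm_Aut sE mE" and \<alpha>\<iota>: "\<And>a. \<alpha> (\<iota> a) = \<iota> (\<beta> a)" and \<pi>\<alpha>: "\<And>b. \<pi> (\<alpha> (s b)) = \<gamma> b"
  shows "linear_section sE sB \<pi> (\<lambda>b. \<alpha> (s (inv \<gamma> b)))"
    and "extension_cocycle mE mB \<iota> (\<lambda>b. \<alpha> (s (inv \<gamma> b))) =
      twisted_cocycle \<beta> \<gamma> (extension_cocycle mE mB \<iota> s)"
proof -
  interpret \<alpha>: Vector_Spaces.linear sE sE \<alpha> using perm_AutD(1)[OF \<alpha>] .
  interpret i: Vector_Spaces.linear sB sB "inv \<gamma>"
    by (rule linear_inv_of_bij[OF perm_AutD(1,3)[OF \<gamma>]])
  have \<beta>inv: "\<beta> (inv \<beta> a) = a" for a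
    using perm_AutD(3)[OF \<beta>] by (simp add: bij_is_surj surj_f_inv_f)
  have \<gamma>inv: "\<gamma> (inv \<gamma> b) = b" for b
    using perm_AutD(3)[OF \<gamma>] by (simp add: bij_is_surj surj_f_inv_f)
  have inv_mult: "inv \<gamma> (mB b b') = mB (inv \<gamma> b) (inv \<gamma> b')" for b b'
    by (rule injD[OF bij_is_inj[OF perm_AutD(3)[OF \<gamma>]]]) (simp add: \<gamma>inv perm_AutD(2)[OF \<gamma>])
  show sec: "linear_section sE sB \<pi> (\<lambda>b. \<alpha> (s (inv \<gamma> b)))"
    using s by (simp add: linear_section_iff i.add i.scale \<alpha>.add \<alpha>.scale \<pi>\<alpha> \<gamma>inv)
  obtain l r \<chi> where c: "extension_cocycle mE mB \<iota> s = (l, r, \<chi>)"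
    and lrx: "\<And>b a. \<iota> (l b a) = mE (s b) (\<iota> a)" "\<And>a b. \<iota> (r a b) = mE (\<iota> a) (s b)"
      "\<And>b b'. \<iota> (\<chi> b b') = mE (s b) (s b') - s (mB b b')"
    by (rule extension_cocycleE[OF s]) blast
  show "extension_cocycle mE mB \<iota> (\<lambda>b. \<alpha> (s (inv \<gamma> b))) =
      twisted_cocycle \<beta> \<gamma> (extension_cocycle mE mB \<iota> s)"
    unfolding c twisted_cocycle.simps extension_cocycle_eq_iff[OF sec]
    \<comment> \<open>Values \<open>\<iota> (\<beta> _)\<close> are rewritten as \<open>\<alpha> (\<iota> _)\<close> to expose the cocycle of \<open>s\<close>; afterwards
      \<open>\<alpha> (\<iota> (inv \<beta> a))\<close> is rewritten back to \<open>\<iota> a\<close>.\<close>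
    by (simp add: \<alpha>\<iota>[symmetric] lrx perm_AutD(2)[OF \<alpha>] \<alpha>.diff inv_mult)
      (simp add: \<alpha>\<iota> \<beta>inv)
qed

text \<open>The map \<open>\<iota> a + s b \<mapsto> \<iota> (\<beta> a) + s' (\<gamma> b)\<close> is multiplicative when the cocycle of \<open>s'\<close> is the twist
  of the cocycle of \<open>s\<close>, because \<open>\<beta> \<times> \<gamma>\<close> carries the product given by a triple to the product given
  by its twist.\<close>

lemma cocycle_product_twisted:
  assumes \<beta>: "\<beta> \<in> perm_Aut sA mA" and \<gamma>: "\<gamma> \<in> perm_Aut sB mB"
  shows "map_prod \<beta> \<gamma> (cocycle_product mA mB c x y) =
    cocycle_product mA mB (twisted_cocycle \<beta> \<gamma> c) (map_prod \<beta> \<gamma> x) (map_prod \<beta> \<gamma> y)"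
proof -
  interpret \<beta>: Vector_Spaces.linear sA sA \<beta> using perm_AutD(1)[OF \<beta>] .
  note inv_f_f[OF bij_is_inj[OF perm_AutD(3)[OF \<beta>]], simp]
    inv_f_f[OF bij_is_inj[OF perm_AutD(3)[OF \<gamma>]], simp]
  show ?thesis
    by (cases c rule: prod_cases3; cases x; cases y)
      (simp add: \<beta>.add perm_AutD(2)[OF \<beta>] perm_AutD(2)[OF \<gamma>])
qed

lemma inducible_of_section:
  assumes s: "linear_section sE sB \<pi> s" and \<beta>: "\<beta> \<in> perm_Aut sA mA" and \<gamma>: "\<gamma> \<in> perm_Aut sB mB"
    and s': "linear_section sE sB \<pi> s'"
    and tw: "extension_cocycle mE mB \<iota> s' = twisted_cocycle \<beta> \<gamma> (extension_cocycle mE mB \<iota> s)"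
  shows "inducible sE mE \<iota> \<pi> s (\<beta>, \<gamma>)"
proof -
  interpret \<beta>: Vector_Spaces.linear sA sA \<beta> using perm_AutD(1)[OF \<beta>] .
  interpret \<gamma>: Vector_Spaces.linear sB sB \<gamma> using perm_AutD(1)[OF \<gamma>] .
  define \<alpha> where "\<alpha> = glue \<iota> s' \<circ> map_prod \<beta> \<gamma> \<circ> inv (glue \<iota> s)"
  have \<alpha>_glue: "\<alpha> (glue \<iota> s x) = glue \<iota> s' (map_prod \<beta> \<gamma> x)" for x
    by (simp add: \<alpha>_def inv_f_f[OF bij_is_inj[OF bij_glue[OF s]]])
  have "bij (map_prod \<beta> \<gamma>)"
    using perm_AutD(3)[OF \<beta>] perm_AutD(3)[OF \<gamma>]
    by (simp add: bij_def prod.inj_map map_prod_surj)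
  then have "bij \<alpha>"
    unfolding \<alpha>_def by (intro bij_comp bij_imp_bij_inv bij_glue s s')
  moreover have "Vector_Spaces.linear sE sE \<alpha>"
  proof -
    have "Vector_Spaces.linear AB.scale AB.scale (map_prod \<beta> \<gamma>)"
      by (simp add: Vector_Spaces.linear_iff AB.p.vector_space_axioms AB.scale_def \<beta>.add \<gamma>.add \<beta>.scale \<gamma>.scale
          plus_prod_def)
    then show ?thesis
      unfolding \<alpha>_def
      by (intro Vector_Spaces.linear_compose[OF linear_inv_of_bij[OF linear_glue[OF s] bij_glue[OF s]]]
          Vector_Spaces.linear_compose[OF _ linear_glue[OF s']])
  qed
  moreover have "\<alpha> (mE e e') = mE (\<alpha> e) (\<alpha> e')" for e e'
  proof -
    obtain x y where "e = glue \<iota> s x" "e' = glue \<iota> s y"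
      using bij_is_surj[OF bij_glue[OF s]] by (metis surjD)
    then show ?thesis
      by (simp add: \<alpha>_glue glue_cocycle_product[OF s, symmetric] cocycle_product_twisted[OF \<beta> \<gamma>]
          tw[symmetric] glue_cocycle_product[OF s'])
  qed
  ultimately have \<alpha>: "\<alpha> \<in> perm_Aut sE mE" by (simp add: perm_Aut_def perm_hom_def)
  have s0: "s 0 = 0" "s' 0 = 0" and pis': "\<pi> (s' b) = b" for b
    using s s' unfolding linear_section_iff by (metis add_cancel_right_left)+
  show ?thesis
  proof (rule inducibleI[OF \<alpha>])
    show "\<alpha> (\<iota> a) = \<iota> (\<beta> a)" for a
      using \<alpha>_glue[of "(a, 0)"] by (simp add: glue_def s0 \<gamma>.zero)
    show "surj \<beta>" using perm_AutD(3)[OF \<beta>] by (rule bij_is_surj)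
    show "\<pi> (\<alpha> (s b)) = \<gamma> b" for b
      using \<alpha>_glue[of "(0, b)"] by (simp add: glue_def iota.zero \<beta>.zero pis')
  qed
qed

lemma inducible_iff_section:
  assumes s: "linear_section sE sB \<pi> s" and \<beta>: "\<beta> \<in> perm_Aut sA mA" and \<gamma>: "\<gamma> \<in> perm_Aut sB mB"
  shows "inducible sE mE \<iota> \<pi> s (\<beta>, \<gamma>) \<longleftrightarrow>
    (\<exists>s'. linear_section sE sB \<pi> s' \<and>
      extension_cocycle mE mB \<iota> s' = twisted_cocycle \<beta> \<gamma> (extension_cocycle mE mB \<iota> s))"
proof
  assume "inducible sE mE \<iota> \<pi> s (\<beta>, \<gamma>)"
  then obtain \<alpha> where "\<alpha> \<in> perm_Aut sE mE" "\<And>a. \<alpha> (\<iota> a) = \<iota> (\<beta> a)" "\<And>b. \<pi> (\<alpha> (s b)) = \<gamma> b"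
    by (rule inducibleE) blast
  from extension_cocycle_transport[OF s \<beta> \<gamma> this]
  show "\<exists>s'. linear_section sE sB \<pi> s' \<and>
      extension_cocycle mE mB \<iota> s' = twisted_cocycle \<beta> \<gamma> (extension_cocycle mE mB \<iota> s)"
    by blast
qed (use inducible_of_section[OF s \<beta> \<gamma>] in blast)

end

section \<open>Inducible pairs of automorphisms\<close>

theorem theorem3p6:
  fixes sA :: "'k::field_char_0 \<Rightarrow> 'a::ab_group_add \<Rightarrow> 'a" and mA :: "'a \<Rightarrow> 'a \<Rightarrow> 'a"
    and sE :: "'k \<Rightarrow> 'e::ab_group_add \<Rightarrow> 'e" and mE :: "'e \<Rightarrow> 'e \<Rightarrow> 'e"
    and sB :: "'k \<Rightarrow> 'b::ab_group_add \<Rightarrow> 'b" and mB :: "'b \<Rightarrow> 'b \<Rightarrow> 'b"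
    and \<iota> :: "'a \<Rightarrow> 'e" and \<pi> :: "'e \<Rightarrow> 'b" and \<sigma> :: "'b \<Rightarrow> 'e"
    and \<beta> :: "'a \<Rightarrow> 'a" and \<gamma> :: "'b \<Rightarrow> 'b"
  assumes "nonabelian_extension sA mA sE mE sB mB \<iota> \<pi>"
    and "linear_section sE sB \<pi> \<sigma>"
    and "(\<beta>, \<gamma>) \<in> perm_Aut sA mA \<times> perm_Aut sB mB"
  shows "inducible sE mE \<iota> \<pi> \<sigma> (\<beta>, \<gamma>) \<longleftrightarrow>
    equivalent_cocycles sA mA sB mB
      (extension_cocycle mE mB \<iota> \<sigma>)
      (twisted_cocycle \<beta> \<gamma> (extension_cocycle mE mB \<iota> \<sigma>))"
proof -
  interpret nonabelian_extension sA mA sE mE sB mB \<iota> \<pi> by (rule assms(1))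
  show ?thesis
    using assms(3) inducible_iff_section[OF assms(2)]
      equivalent_cocycles_extension_cocycle_iff[OF assms(2)] by simp
qed

end
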